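(* There is a constant $c_K>1$, depending only on $p$, such that the following holds. Let $\varepsilon=[\varepsilon_-,\varepsilon_+]$ with $0<\varepsilon_-\le\varepsilon_+<\infty$, let $v_0\in W_0^{1,2}(\Omega)$ be arbitrary, and let $(v_n)_{n\ge0}$ be defined recursively by letting $v_{n+1}\in W_0^{1,2}(\Omega)$ be the solution of $$\int_\Omega(\varepsilon_-\vee|\nabla v_n|\wedge\varepsilon_+)^{p-2}\,\nabla v_{n+1}\cdot\nabla\xi\,dx=\langle f,\xi\rangle\qquad\text{for all }\xi\in W_0^{1,2}(\Omega).$$ Then for all $n\ge0$ $$\mathcal J_\varepsilon(v_n)-\mathcal J_\varepsilon(v_{n+1})\ge\delta\,\big(\mathcal J_\varepsilon(v_n)-\mathcal J_\varepsilon(u_\varepsilon)\big)\qquad\text{with}\quad\delta:=\frac1{c_K}\Big(\frac{\varepsilon_-}{\varepsilon_+}\Big)^{2-p}.$$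
   Context: Standing setting: $\Omega\subset\mathbb R^d$ is open and bounded, $1<p<2$, $f\in (W_0^{1,p}(\Omega))^*$. Notation: $\varepsilon_-\vee t\wedge\varepsilon_+:=\max\{\varepsilon_-,\min\{t,\varepsilon_+\}\}$. For $\varepsilon=[\varepsilon_-,\varepsilon_+]$ with $0<\varepsilon_-\le\varepsilon_+<\infty$ define $$\kappa_\varepsilon(t):=\begin{cases}\frac12\varepsilon_-^{p-2}t^2+(\frac1p-\frac12)\varepsilon_-^p & t\le\varepsilon_-,\\ \frac1p t^p & \varepsilon_-\le t\le\varepsilon_+,\\ \frac12\varepsilon_+^{p-2}t^2+(\frac1p-\frac12)\varepsilon_+^p & t\ge\varepsilon_+,\end{cases}$$ and $\mathcal J_\varepsilon(v):=\int_\Omega\kappa_\varepsilon(|\nabla v|)\,dx-\langle f,v\rangle$. The functional $\mathcal J_\varepsilon$ is finite exactly on $W_0^{1,2}(\Omega)$ and $u_\varepsilon$ denotes its unique minimizer. *)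

theory Defs
  imports "HOL-Analysis.Analysis"
begin

text \<open>
  The dimension \<open>d\<close> has to be quantified after the constant of the theorem, so it is a natural
  number rather than a type: points of \<open>\<real>\<^sup>d\<close> are the elements of
  \<open>{..<d} \<rightarrow>\<^sub>E UNIV\<close>, with product topology, product Lebesgue measure on Borel sets, and
  Euclidean norm \<open>L2_set x {..<d}\<close>. Scalar functions have type \<open>(nat \<Rightarrow> real) \<Rightarrow> real\<close>; of a vector
  field only the components with index below \<open>d\<close> matter.
\<close>

abbreviation Rd :: "nat \<Rightarrow> (nat \<Rightarrow> real) topology" where
  "Rd d \<equiv> product_topology (\<lambda>_. euclideanreal) {..<d}"

definition vol :: "nat \<Rightarrow> (nat \<Rightarrow> real) set \<Rightarrow> (nat \<Rightarrow> real) measure" where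
  "vol d \<Omega> = restrict_space (Pi\<^sub>M {..<d} (\<lambda>_. lborel)) \<Omega>"

definition bounded_open :: "nat \<Rightarrow> (nat \<Rightarrow> real) set \<Rightarrow> bool" where
  "bounded_open d \<Omega> \<longleftrightarrow> openin (Rd d) \<Omega> \<and> (\<exists>B. \<forall>x\<in>\<Omega>. L2_set x {..<d} \<le> B)"

definition dot :: "nat \<Rightarrow> (nat \<Rightarrow> real) \<Rightarrow> (nat \<Rightarrow> real) \<Rightarrow> real" where
  "dot d x y = (\<Sum>i<d. x i * y i)"

definition partial_deriv :: "nat \<Rightarrow> ((nat \<Rightarrow> real) \<Rightarrow> real) \<Rightarrow> (nat \<Rightarrow> real) \<Rightarrow> real" where
  "partial_deriv i \<phi> x = deriv (\<lambda>t. \<phi> (x(i := t))) (x i)"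

definition smooth :: "nat \<Rightarrow> ((nat \<Rightarrow> real) \<Rightarrow> real) \<Rightarrow> bool" where
  "smooth d \<phi> \<longleftrightarrow>
     (\<forall>is. set is \<subseteq> {..<d} \<longrightarrow>
        continuous_map (Rd d) euclideanreal (foldr partial_deriv is \<phi>) \<and>
        (\<forall>x\<in>topspace (Rd d). \<forall>i<d.
           (\<lambda>t. foldr partial_deriv is \<phi> (x(i := t))) differentiable (at (x i))))"

definition test_function :: "nat \<Rightarrow> (nat \<Rightarrow> real) set \<Rightarrow> ((nat \<Rightarrow> real) \<Rightarrow> real) \<Rightarrow> bool" where
  "test_function d \<Omega> \<phi> \<longleftrightarrow>
     smooth d \<phi> \<and>
     (\<exists>K. compactin (Rd d) K \<and> K \<subseteq> \<Omega> \<and> (\<forall>x\<in>topspace (Rd d) - K. \<phi> x = 0))"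

definition locally_integrable :: "nat \<Rightarrow> (nat \<Rightarrow> real) set \<Rightarrow> ((nat \<Rightarrow> real) \<Rightarrow> real) \<Rightarrow> bool" where
  "locally_integrable d \<Omega> g \<longleftrightarrow>
     g \<in> borel_measurable (vol d \<Omega>) \<and>
     (\<forall>K. compactin (Rd d) K \<and> K \<subseteq> \<Omega> \<longrightarrow> integrable (vol d K) g)"

definition has_weak_gradient ::
  "nat \<Rightarrow> (nat \<Rightarrow> real) set \<Rightarrow> ((nat \<Rightarrow> real) \<Rightarrow> real) \<Rightarrow> ((nat \<Rightarrow> real) \<Rightarrow> nat \<Rightarrow> real) \<Rightarrow> bool" where
  "has_weak_gradient d \<Omega> u G \<longleftrightarrow>
     locally_integrable d \<Omega> u \<and>
     (\<forall>i<d. locally_integrable d \<Omega> (\<lambda>x. G x i) \<and>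
        (\<forall>\<phi>. test_function d \<Omega> \<phi> \<longrightarrow>
           (LINT x|vol d \<Omega>. u x * partial_deriv i \<phi> x) = - (LINT x|vol d \<Omega>. G x i * \<phi> x)))"

text \<open>A representative of the weak gradient, which is unique only almost everywhere on \<open>\<Omega>\<close>.\<close>

definition weak_gradient ::
  "nat \<Rightarrow> (nat \<Rightarrow> real) set \<Rightarrow> ((nat \<Rightarrow> real) \<Rightarrow> real) \<Rightarrow> (nat \<Rightarrow> real) \<Rightarrow> nat \<Rightarrow> real" where
  "weak_gradient d \<Omega> u = (SOME G. has_weak_gradient d \<Omega> u G)"

definition grad_norm ::
  "nat \<Rightarrow> (nat \<Rightarrow> real) set \<Rightarrow> ((nat \<Rightarrow> real) \<Rightarrow> real) \<Rightarrow> (nat \<Rightarrow> real) \<Rightarrow> real" where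
  "grad_norm d \<Omega> u x = L2_set (weak_gradient d \<Omega> u x) {..<d}"

text \<open>
  The elements of the following spaces are functions rather than equivalence classes modulo
  equality almost everywhere on \<open>\<Omega>\<close>; their values outside \<open>\<Omega>\<close> are irrelevant.
\<close>

definition Lebesgue_space :: "nat \<Rightarrow> real \<Rightarrow> (nat \<Rightarrow> real) set \<Rightarrow> ((nat \<Rightarrow> real) \<Rightarrow> real) set" where
  "Lebesgue_space d q \<Omega> =
     {g. g \<in> borel_measurable (vol d \<Omega>) \<and> integrable (vol d \<Omega>) (\<lambda>x. \<bar>g x\<bar> powr q)}"

definition W1 :: "nat \<Rightarrow> real \<Rightarrow> (nat \<Rightarrow> real) set \<Rightarrow> ((nat \<Rightarrow> real) \<Rightarrow> real) set" where
  "W1 d q \<Omega> =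
     {u \<in> Lebesgue_space d q \<Omega>.
        \<exists>G. has_weak_gradient d \<Omega> u G \<and> (\<forall>i<d. (\<lambda>x. G x i) \<in> Lebesgue_space d q \<Omega>)}"

definition W1_norm :: "nat \<Rightarrow> real \<Rightarrow> (nat \<Rightarrow> real) set \<Rightarrow> ((nat \<Rightarrow> real) \<Rightarrow> real) \<Rightarrow> real" where
  "W1_norm d q \<Omega> u =
     ((LINT x|vol d \<Omega>. \<bar>u x\<bar> powr q) + (LINT x|vol d \<Omega>. grad_norm d \<Omega> u x powr q)) powr (1 / q)"

definition W1_0 :: "nat \<Rightarrow> real \<Rightarrow> (nat \<Rightarrow> real) set \<Rightarrow> ((nat \<Rightarrow> real) \<Rightarrow> real) set" where
  "W1_0 d q \<Omega> =
     {u \<in> W1 d q \<Omega>.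
        \<exists>\<phi>. (\<forall>k::nat. test_function d \<Omega> (\<phi> k)) \<and>
            (\<lambda>k. W1_norm d q \<Omega> (\<lambda>x. u x - \<phi> k x)) \<longlonglongrightarrow> 0}"

text \<open>
  The dual space. Boundedness forces a functional to take equal values on functions that agree
  almost everywhere on \<open>\<Omega>\<close>.
\<close>

definition W1_0_dual :: "nat \<Rightarrow> real \<Rightarrow> (nat \<Rightarrow> real) set \<Rightarrow> (((nat \<Rightarrow> real) \<Rightarrow> real) \<Rightarrow> real) set" where
  "W1_0_dual d q \<Omega> =
     {f. (\<forall>u\<in>W1_0 d q \<Omega>. \<forall>v\<in>W1_0 d q \<Omega>. f (\<lambda>x. u x + v x) = f u + f v) \<and>
         (\<forall>u\<in>W1_0 d q \<Omega>. \<forall>c. f (\<lambda>x. c * u x) = c * f u) \<and>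
         (\<exists>C. \<forall>u\<in>W1_0 d q \<Omega>. \<bar>f u\<bar> \<le> C * W1_norm d q \<Omega> u)}"

definition clamp_to :: "real \<Rightarrow> real \<Rightarrow> real \<Rightarrow> real" where
  "clamp_to em ep t = max em (min t ep)"

definition kappa :: "real \<Rightarrow> real \<Rightarrow> real \<Rightarrow> real \<Rightarrow> real" where
  "kappa p em ep t =
     (if t \<le> em then 1/2 * em powr (p - 2) * t\<^sup>2 + (1/p - 1/2) * em powr p
      else if t \<le> ep then 1/p * t powr p
      else 1/2 * ep powr (p - 2) * t\<^sup>2 + (1/p - 1/2) * ep powr p)"

text \<open>
  Here \<open>em\<close> and \<open>ep\<close> are the relaxation parameters \<open>\<epsilon>\<^sub>-\<close> and \<open>\<epsilon>\<^sub>+\<close>. The energy is only meaningful for \<open>v\<close> in \<open>W\<^sub>0\<^sup>1\<^sup>,\<^sup>2(\<Omega>)\<close>, where the integrand is integrable; accordingly minimizers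
  are taken over this space.
\<close>

definition energy ::
  "nat \<Rightarrow> (nat \<Rightarrow> real) set \<Rightarrow> real \<Rightarrow> (((nat \<Rightarrow> real) \<Rightarrow> real) \<Rightarrow> real) \<Rightarrow> real \<Rightarrow> real \<Rightarrow>
   ((nat \<Rightarrow> real) \<Rightarrow> real) \<Rightarrow> real" where
  "energy d \<Omega> p f em ep v = (LINT x|vol d \<Omega>. kappa p em ep (grad_norm d \<Omega> v x)) - f v"

definition is_energy_minimizer ::
  "nat \<Rightarrow> (nat \<Rightarrow> real) set \<Rightarrow> real \<Rightarrow> (((nat \<Rightarrow> real) \<Rightarrow> real) \<Rightarrow> real) \<Rightarrow> real \<Rightarrow> real \<Rightarrow>
   ((nat \<Rightarrow> real) \<Rightarrow> real) \<Rightarrow> bool" where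
  "is_energy_minimizer d \<Omega> p f em ep u \<longleftrightarrow>
     u \<in> W1_0 d 2 \<Omega> \<and> (\<forall>w\<in>W1_0 d 2 \<Omega>. energy d \<Omega> p f em ep u \<le> energy d \<Omega> p f em ep w)"

definition is_kacanov_step ::
  "nat \<Rightarrow> (nat \<Rightarrow> real) set \<Rightarrow> real \<Rightarrow> (((nat \<Rightarrow> real) \<Rightarrow> real) \<Rightarrow> real) \<Rightarrow> real \<Rightarrow> real \<Rightarrow>
   ((nat \<Rightarrow> real) \<Rightarrow> real) \<Rightarrow> ((nat \<Rightarrow> real) \<Rightarrow> real) \<Rightarrow> bool" where
  "is_kacanov_step d \<Omega> p f em ep v w \<longleftrightarrow>
     w \<in> W1_0 d 2 \<Omega> \<and>
     (\<forall>\<xi>\<in>W1_0 d 2 \<Omega>.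
        (LINT x|vol d \<Omega>. clamp_to em ep (grad_norm d \<Omega> v x) powr (p - 2) *
            dot d (weak_gradient d \<Omega> w x) (weak_gradient d \<Omega> \<xi> x)) = f \<xi>)"

end

theory Submission
  imports Defs
begin

text \<open>
  Let \<open>A, B, C\<close> be the gradients of \<open>v\<^sub>n, v\<^sub>n\<^sub>+\<^sub>1, u\<close> and let \<open>a(t)\<close> be the clamped weight, so that
  \<open>kappa' t = a(t) t\<close>. Testing the equation for \<open>v\<^sub>n\<^sub>+\<^sub>1\<close> turns \<open>f\<close> into the integral of \<open>a(|A|) B \<cdot> _\<close>.
  As \<open>kappa\<close> is concave in \<open>t\<^sup>2\<close>, the energy decrease is at least the integral of
  \<open>a(|A|) |A - B|\<^sup>2 / 2\<close>. As \<open>kappa\<close> is strongly convex with modulus \<open>\<lambda> = (p - 1) ep\<^sup>p\<^sup>-\<^sup>2\<close>, Young's inequality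
  bounds the energy excess over \<open>u\<close> by the integral of \<open>a(|A|)\<^sup>2 |A - B|\<^sup>2 / (2 \<lambda>)\<close>. Since
  \<open>a \<le> em\<^sup>p\<^sup>-\<^sup>2\<close>, the claim holds with \<open>cK = 1 / (p - 1)\<close>.

  The chosen representative of the weak gradient need not obviously be square integrable. This follows
  from its uniqueness almost everywhere, that is, from the fundamental lemma of the calculus of
  variations, proved with explicit bump functions approximating indicators of boxes.
\<close>

subsection \<open>Smooth bump functions on boxes\<close>

text \<open>The classical flat function \<open>exp (- 1 / t)\<close> with an extra negative power of
  \<open>t\<close>. The powers are carried along because differentiation produces them, so that the
  family spans a space closed under derivatives.\<close>

definition flat_exp :: "nat \<Rightarrow> real \<Rightarrow> real" where
  "flat_exp n t = (if t > 0 then exp (- 1 / t) / t ^ n else 0)"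

lemma flat_exp_nonneg: "0 \<le> flat_exp n t"
  by (simp add: flat_exp_def)

text \<open>The exponential series of \<open>exp (1 / t)\<close> dominates its single term of index
  \<open>n + 2\<close>; inverting gives \<open>t ^ (n + 2)\<close>, and division by
  \<open>t ^ n\<close> leaves a square. One power more than linear is what kills the difference
  quotient at 0.\<close>

lemma flat_exp_le:
  assumes "0 < t"
  shows "flat_exp n t \<le> fact (n + 2) * t\<^sup>2"
proof -
  have "(1 / t) ^ (n + 2) / fact (n + 2) \<le> exp (1 / t)"
  proof -
    have "(1 / t) ^ (n + 2) /\<^sub>R fact (n + 2) \<le> (\<Sum>k. (1 / t) ^ k /\<^sub>R fact k)"
      using sum_le_suminf[OF summable_exp_generic, of "{n + 2}" "1 / t"] assms by simp
    then show ?thesis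
      by (simp add: exp_def divide_inverse mult.commute)
  qed
  then have "exp (- (1 / t)) \<le> fact (n + 2) * t ^ (n + 2)"
    using assms by (simp add: exp_minus power_one_over pos_divide_le_eq
        divide_le_eq inverse_eq_divide mult.commute mult.left_commute del: fact_Suc power_Suc)
  then show ?thesis
    using assms by (simp add: flat_exp_def pos_divide_le_eq power_add power2_eq_square ac_simps
        del: fact_Suc)
qed

lemma flat_exp_has_derivative:
  "(flat_exp n has_real_derivative (flat_exp (n + 2) t - real n * flat_exp (n + 1) t)) (at t)"
proof -
  consider "t > 0" | "t < 0" | "t = 0" by linarith
  then show ?thesis
  proof cases
    case 1
    \<comment> \<open>The case \<open>n = 0\<close> is separate because \<open>n - 1\<close> is
      truncated; the factor \<open>real n\<close> makes both sides vanish there.\<close>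
    have pow: "real n * t ^ (n - 1) = real n * t ^ n / t"
      using 1 by (cases n) auto
    have "((\<lambda>t. exp (- 1 / t) / t ^ n) has_real_derivative
        (exp (- 1 / t) / t\<^sup>2 * t ^ n - exp (- 1 / t) * (real n * t ^ (n - 1))) / (t ^ n * t ^ n)) (at t)"
      using 1 by (auto intro!: derivative_eq_intros simp: power2_eq_square)
    moreover have "(exp (- 1 / t) / t\<^sup>2 * t ^ n - exp (- 1 / t) * (real n * t ^ (n - 1))) / (t ^ n * t ^ n)
        = flat_exp (n + 2) t - real n * flat_exp (n + 1) t"
      unfolding pow using 1 by (simp add: flat_exp_def field_simps power2_eq_square)
    ultimately have "((\<lambda>t. exp (- 1 / t) / t ^ n) has_real_derivative
        (flat_exp (n + 2) t - real n * flat_exp (n + 1) t)) (at t)"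
      by simp
    moreover have "\<forall>\<^sub>F s in nhds t. flat_exp n s = exp (- 1 / s) / s ^ n"
      using eventually_nhds_in_open[of "{0<..}" t] 1
      by (auto simp: flat_exp_def elim: eventually_mono)
    ultimately show ?thesis
      by (subst DERIV_cong_ev[OF refl _ refl]) auto
  next
    case 2
    have "\<forall>\<^sub>F s in nhds t. flat_exp n s = 0"
      using eventually_nhds_in_open[of "{..<0}" t] 2
      by (auto simp: flat_exp_def elim: eventually_mono)
    then show ?thesis
      using 2 by (subst DERIV_cong_ev[OF refl _ refl]) (auto simp: flat_exp_def)
  next
    case 3
    \<comment> \<open>At 0 the claimed derivative is 0, since \<open>flat_exp\<close> vanishes there
      by definition. The quadratic bound makes the difference quotient of order
      \<open>h\<close>.\<close>
    have "((\<lambda>h. flat_exp n h / h) \<longlongrightarrow> 0) (at 0)"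
    proof (rule Lim_null_comparison)
      have "norm (flat_exp n h / h) \<le> fact (n + 2) * \<bar>h\<bar>" for h
      proof (cases "h > 0")
        case True
        then have "flat_exp n h / h \<le> fact (n + 2) * h\<^sup>2 / h"
          by (intro divide_right_mono flat_exp_le) auto
        with True flat_exp_nonneg[of n h] show ?thesis
          by (simp add: power2_eq_square)
      next
        case False
        have "0 \<le> fact (n + 2) * \<bar>h\<bar>"
          by (intro mult_nonneg_nonneg) auto
        moreover have "flat_exp n h = 0"
          using False by (simp add: flat_exp_def)
        ultimately show ?thesis by (simp only: div_0 norm_zero)
      qed
      then show "\<forall>\<^sub>F h in at 0. norm (flat_exp n h / h) \<le> fact (n + 2) * \<bar>h\<bar>" by simp
      show "((\<lambda>h. fact (n + 2) * \<bar>h\<bar>) \<longlongrightarrow> (0::real)) (at 0)"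
        by (auto intro!: tendsto_eq_intros)
    qed
    then show ?thesis
      using 3 by (simp add: DERIV_def flat_exp_def)
  qed
qed

text \<open>A class of functions closed under differentiation, so that its members are smooth.\<close>

inductive_set elementary_smooth :: "(real \<Rightarrow> real) set" where
  const: "(\<lambda>_. c) \<in> elementary_smooth"
| flat: "(\<lambda>t. flat_exp n (c * t + e)) \<in> elementary_smooth"
| add: "f \<in> elementary_smooth \<Longrightarrow> g \<in> elementary_smooth \<Longrightarrow> (\<lambda>t. f t + g t) \<in> elementary_smooth"
| mult: "f \<in> elementary_smooth \<Longrightarrow> g \<in> elementary_smooth \<Longrightarrow> (\<lambda>t. f t * g t) \<in> elementary_smooth"

lemma elementary_smooth_has_derivative:
  "f \<in> elementary_smooth \<Longrightarrow> \<exists>f'\<in>elementary_smooth. \<forall>t. (f has_real_derivative f' t) (at t)"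
proof (induction rule: elementary_smooth.induct)
  case (const c)
  show ?case
    by (rule bexI[of _ "\<lambda>_. 0"]) (auto intro: elementary_smooth.intros)
next
  case (flat n c e)
  \<comment> \<open>The difference is written as a sum with the constant factor
    \<open>- real n\<close>, so that the closure rules apply literally.\<close>
  let ?f' = "\<lambda>t. c * (flat_exp (n + 2) (c * t + e) + (- real n) * flat_exp (n + 1) (c * t + e))"
  have "?f' \<in> elementary_smooth"
    by (intro elementary_smooth.intros)
  moreover have "((\<lambda>t. flat_exp n (c * t + e)) has_real_derivative ?f' t) (at t)" for t
    using DERIV_chain2[OF flat_exp_has_derivative, of "\<lambda>t. c * t + e" c]
    by (fastforce intro!: derivative_eq_intros simp: mult.commute[of c])
  ultimately show ?case by (intro bexI[of _ ?f']) blast+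
next
  case (add f g)
  then obtain f' g' where "f' \<in> elementary_smooth" "g' \<in> elementary_smooth"
    "\<And>t. (f has_real_derivative f' t) (at t)" "\<And>t. (g has_real_derivative g' t) (at t)"
    by blast
  then show ?case
    by (intro bexI[of _ "\<lambda>t. f' t + g' t"]) (auto intro!: elementary_smooth.add DERIV_add)
next
  case (mult f g)
  then obtain f' g' where "f' \<in> elementary_smooth" "g' \<in> elementary_smooth"
    "\<And>t. (f has_real_derivative f' t) (at t)" "\<And>t. (g has_real_derivative g' t) (at t)"
    by blast
  with mult.hyps show ?case
    by (intro bexI[of _ "\<lambda>t. f' t * g t + g' t * f t"])
      (auto intro!: elementary_smooth.intros DERIV_mult)
qed

lemma elementary_smooth_differentiable:
  "f \<in> elementary_smooth \<Longrightarrow> (f has_real_derivative deriv f t) (at t)"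
  using elementary_smooth_has_derivative DERIV_imp_deriv by metis

lemma deriv_elementary_smooth: "f \<in> elementary_smooth \<Longrightarrow> deriv f \<in> elementary_smooth"
  using elementary_smooth_has_derivative[of f] DERIV_imp_deriv[of f] by (metis ext)

lemma elementary_smooth_continuous: "f \<in> elementary_smooth \<Longrightarrow> continuous_on UNIV f"
  using elementary_smooth_differentiable DERIV_isCont continuous_at_imp_continuous_on by blast

text \<open>Only the factor with index \<open>i\<close> depends on the variable, so differentiation
  replaces \<open>g i\<close> by its derivative and keeps the product form.\<close>

lemma tensor_product_has_derivative:
  fixes d :: nat
  assumes "\<And>j. j < d \<Longrightarrow> g j \<in> elementary_smooth" "i < d"
  shows "((\<lambda>t. \<Prod>j<d. g j ((x(i := t)) j)) has_real_derivative
    (\<Prod>j<d. (g(i := deriv (g i))) j ((x(i := s)) j))) (at s)"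
proof -
  have "((\<lambda>t. g i t * (\<Prod>j\<in>{..<d}-{i}. g j (x j))) has_real_derivative
      deriv (g i) s * (\<Prod>j\<in>{..<d}-{i}. g j (x j))) (at s)"
    using elementary_smooth_differentiable[of "g i" s] assms
    by (auto intro!: derivative_eq_intros)
  also have "deriv (g i) s * (\<Prod>j\<in>{..<d}-{i}. g j (x j)) =
      (\<Prod>j<d. (g(i := deriv (g i))) j ((x(i := s)) j))"
    using assms(2) by (subst prod.remove[of "{..<d}" i]) auto
  also have "(\<lambda>t. g i t * (\<Prod>j\<in>{..<d}-{i}. g j (x j))) = (\<lambda>t. \<Prod>j<d. g j ((x(i := t)) j))"
    using assms(2) by (subst prod.remove[of "{..<d}" i]) auto
  finally show ?thesis .
qed

text \<open>By induction on the list of indices, every iterated partial derivative is again a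
  product of one-variable functions from \<open>elementary_smooth\<close>; continuity and
  differentiability are then read off from the factors.\<close>

lemma smooth_tensor_product:
  assumes "\<And>j. j < d \<Longrightarrow> g j \<in> elementary_smooth"
  shows "smooth d (\<lambda>x. \<Prod>j<d. g j (x j))"
proof -
  have *: "\<exists>h. (\<forall>j<d. h j \<in> elementary_smooth) \<and>
      foldr partial_deriv is (\<lambda>x. \<Prod>j<d. g j (x j)) = (\<lambda>x. \<Prod>j<d. h j (x j))"
    if "set is \<subseteq> {..<d}" for "is"
    using that
  proof (induction "is")
    case Nil
    then show ?case using assms by auto
  next
    case (Cons i "is")
    then obtain h where h: "\<And>j. j < d \<Longrightarrow> h j \<in> elementary_smooth"
      "foldr partial_deriv is (\<lambda>x. \<Prod>j<d. g j (x j)) = (\<lambda>x. \<Prod>j<d. h j (x j))"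
      by auto
    have "partial_deriv i (\<lambda>x. \<Prod>j<d. h j (x j)) =
        (\<lambda>x. \<Prod>j<d. (h(i := deriv (h i))) j (x j))"
    proof
      fix x
      show "partial_deriv i (\<lambda>x. \<Prod>j<d. h j (x j)) x =
        (\<Prod>j<d. (h(i := deriv (h i))) j (x j))"
        unfolding partial_deriv_def
        using tensor_product_has_derivative[of d h i x "x i"] h(1) Cons.prems
        by (intro DERIV_imp_deriv) simp
    qed
    with h Cons.prems show ?case
      by (intro exI[of _ "h(i := deriv (h i))"]) (auto intro: deriv_elementary_smooth)
  qed
  show ?thesis
    unfolding smooth_def
  proof (intro allI impI)
    fix "is" assume "set is \<subseteq> {..<d}"
    then obtain h where h: "\<And>j. j < d \<Longrightarrow> h j \<in> elementary_smooth"
      "foldr partial_deriv is (\<lambda>x. \<Prod>j<d. g j (x j)) = (\<lambda>x. \<Prod>j<d. h j (x j))"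
      using * by blast
    have "continuous_map (Rd d) euclideanreal (\<lambda>x. h j (x j))" if "j < d" for j
    proof -
      have "continuous_map (Rd d) euclideanreal (\<lambda>x. x j)"
        using that by (intro continuous_map_product_projection) auto
      moreover have "continuous_map euclideanreal euclideanreal (h j)"
        using elementary_smooth_continuous[OF h(1)[OF that]] by simp
      ultimately show ?thesis
        using continuous_map_compose[of "Rd d" euclideanreal "\<lambda>x. x j" euclideanreal "h j"]
        by (simp add: o_def)
    qed
    then have "continuous_map (Rd d) euclideanreal (\<lambda>x. \<Prod>j<d. h j (x j))"
      by (intro continuous_map_prod) auto
    moreover have "(\<lambda>t. \<Prod>j<d. h j ((x(i := t)) j)) differentiable at (x i)" if "i < d" for x i
      using tensor_product_has_derivative[of d h i x "x i"] h(1) that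
      by (meson real_differentiable_def)
    ultimately show "continuous_map (Rd d) euclideanreal
          (foldr partial_deriv is (\<lambda>x. \<Prod>j<d. g j (x j))) \<and>
        (\<forall>x\<in>topspace (Rd d). \<forall>i<d. (\<lambda>t. foldr partial_deriv is
          (\<lambda>x. \<Prod>j<d. g j (x j)) (x(i := t))) differentiable (at (x i)))"
      unfolding h(2) by blast
  qed
qed

section \<open>Bumps approximating indicators of boxes\<close>

text \<open>For \<open>k > 0\<close> the \<open>j\<close>-th factor is positive exactly for
  \<open>x j\<close> strictly between \<open>a j\<close> and \<open>b j\<close>. Increasing
  \<open>k\<close> steepens the bump without moving its support.\<close>

definition box_bump :: "nat \<Rightarrow> (nat \<Rightarrow> real) \<Rightarrow> (nat \<Rightarrow> real) \<Rightarrow> real \<Rightarrow> (nat \<Rightarrow> real) \<Rightarrow> real" where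
  "box_bump d a b k x = (\<Prod>j<d. flat_exp 0 (k * (x j - a j)) * flat_exp 0 (k * (b j - x j)))"

lemma flat_exp_0_le_1: "flat_exp 0 t \<le> 1"
  by (simp add: flat_exp_def)

lemma box_bump_range: "0 \<le> box_bump d a b k x" "box_bump d a b k x \<le> 1"
  unfolding box_bump_def
  by (auto intro!: prod_nonneg prod_le_1 mult_nonneg_nonneg mult_le_one
      flat_exp_nonneg flat_exp_0_le_1)

lemma box_bump_eq_0:
  assumes "k \<ge> 0" "i < d" "x i \<le> a i \<or> b i \<le> x i"
  shows "box_bump d a b k x = 0"
proof -
  have "flat_exp 0 (k * (x i - a i)) * flat_exp 0 (k * (b i - x i)) = 0"
    using assms by (auto simp: flat_exp_def zero_less_mult_iff)
  then show ?thesis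
    unfolding box_bump_def using assms(2) by (intro prod_zero) auto
qed

lemma flat_exp_0_tendsto: "0 < t \<Longrightarrow> (\<lambda>k. flat_exp 0 (real k * t)) \<longlonglongrightarrow> 1"
proof -
  assume t: "0 < t"
  have "(\<lambda>k. exp (- (1 / t) * (1 / real k))) \<longlonglongrightarrow> exp (- (1 / t) * 0)"
    by (intro tendsto_intros lim_1_over_n)
  \<comment> \<open>The index \<open>k = 0\<close> has to be excluded: there
    \<open>1 / real k\<close> is 0 by convention, so the left side is 1 while
    \<open>flat_exp\<close> is 0.\<close>
  moreover have "\<forall>\<^sub>F k in sequentially. exp (- (1 / t) * (1 / real k)) = flat_exp 0 (real k * t)"
    using eventually_gt_at_top[of 0]
    by eventually_elim (use t in \<open>simp add: flat_exp_def mult.commute\<close>)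
  ultimately show ?thesis
    by (simp add: filterlim_cong)
qed

text \<open>Inside the open box every factor tends to 1; outside, some factor is 0 for all
  \<open>k\<close>. Extensionality of \<open>x\<close> is part of membership in the product
  set.\<close>

lemma box_bump_tendsto:
  assumes "x \<in> extensional {..<d}"
  shows "(\<lambda>k. box_bump d a b (real k) x) \<longlonglongrightarrow> indicator (\<Pi>\<^sub>E i\<in>{..<d}. {a i<..<b i}) x"
proof (cases "\<forall>i<d. a i < x i \<and> x i < b i")
  case True
  then have "(\<lambda>k. \<Prod>j<d. flat_exp 0 (real k * (x j - a j)) * flat_exp 0 (real k * (b j - x j)))
      \<longlonglongrightarrow> (\<Prod>j<d. 1 * 1)"
    by (intro tendsto_prod tendsto_mult flat_exp_0_tendsto) auto
  with True assms show ?thesis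
    by (simp add: box_bump_def indicator_def PiE_def Pi_def)
next
  case False
  then obtain i where i: "i < d" "x i \<le> a i \<or> b i \<le> x i" by fastforce
  then have "x \<notin> (\<Pi>\<^sub>E i\<in>{..<d}. {a i<..<b i})" by (force simp: PiE_def Pi_def)
  with i show ?thesis by (simp add: box_bump_eq_0)
qed

lemma box_bump_test_function:
  assumes "(\<Pi>\<^sub>E i\<in>{..<d}. {a i..b i}) \<subseteq> \<Omega>" "0 \<le> k"
  shows "test_function d \<Omega> (box_bump d a b k)"
proof -
  \<comment> \<open>The arguments are put into the affine form \<open>c * t + e\<close> that the
    rule \<open>flat\<close> expects.\<close>
  have "(\<lambda>t. flat_exp 0 (k * t + - k * a j) * flat_exp 0 (- k * t + k * b j))
      \<in> elementary_smooth" for j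
    by (intro elementary_smooth.intros)
  from smooth_tensor_product[OF this, of d "\<lambda>j. j"]
  have "smooth d (box_bump d a b k)"
    unfolding box_bump_def[abs_def] by (simp add: algebra_simps)
  moreover have "compactin (Rd d) (\<Pi>\<^sub>E i\<in>{..<d}. {a i..b i})"
    by (simp add: compactin_PiE)
  moreover have "box_bump d a b k x = 0"
    if x: "x \<in> topspace (Rd d) - (\<Pi>\<^sub>E i\<in>{..<d}. {a i..b i})" for x
  proof -
    obtain i where "i < d" "x i < a i \<or> b i < x i"
      using x by (auto simp: PiE_iff not_le)
    then show ?thesis
      by (intro box_bump_eq_0[OF assms(2)]) auto
  qed
  ultimately show ?thesis
    unfolding test_function_def using assms(1) by blast
qed

subsection \<open>Uniqueness of the weak gradient\<close>

abbreviation lebesgue_Rd :: "nat \<Rightarrow> (nat \<Rightarrow> real) measure" where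
  "lebesgue_Rd d \<equiv> Pi\<^sub>M {..<d} (\<lambda>_. lborel)"

definition open_box :: "nat \<Rightarrow> (nat \<Rightarrow> real) \<Rightarrow> (nat \<Rightarrow> real) \<Rightarrow> (nat \<Rightarrow> real) set" where
  "open_box d a b = (\<Pi>\<^sub>E i\<in>{..<d}. {a i<..<b i})"

definition closed_box :: "nat \<Rightarrow> (nat \<Rightarrow> real) \<Rightarrow> (nat \<Rightarrow> real) \<Rightarrow> (nat \<Rightarrow> real) set" where
  "closed_box d a b = (\<Pi>\<^sub>E i\<in>{..<d}. {a i..b i})"

lemma open_box_subset_closed_box: "open_box d a b \<subseteq> closed_box d a b"
  unfolding open_box_def closed_box_def by (intro PiE_mono) auto

lemma sets_open_box [measurable]: "open_box d a b \<in> sets (lebesgue_Rd d)"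
  unfolding open_box_def by (intro sets_PiM_I_finite) auto

lemma sets_closed_box [measurable]: "closed_box d a b \<in> sets (lebesgue_Rd d)"
  unfolding closed_box_def by (intro sets_PiM_I_finite) auto

lemma open_box_Int:
  "open_box d a b \<inter> open_box d a' b' = open_box d (\<lambda>i. max (a i) (a' i)) (\<lambda>i. min (b i) (b' i))"
  by (simp add: open_box_def PiE_Int)

lemma closed_box_mono:
  assumes "\<And>i. i < d \<Longrightarrow> a i \<le> a' i" "\<And>i. i < d \<Longrightarrow> b' i \<le> b i"
  shows "closed_box d a' b' \<subseteq> closed_box d a b"
  unfolding closed_box_def using assms by (intro PiE_mono atLeastatMost_subset_iff[THEN iffD2]) auto

text \<open>Open intervals generate the Borel sets of the line, and \<open>sets_PiM_sigma\<close>
  lifts generators to the product. Taking \<open>{..<d}\<close> as the only index set turns its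
  cylinders into full boxes.\<close>

lemma sets_lebesgue_Rd_eq_boxes:
  "sets (lebesgue_Rd d) = sigma_sets (space (lebesgue_Rd d)) (range (\<lambda>(a, b). open_box d a b))"
proof -
  let ?E = "range (\<lambda>(a, b). {a<..<b}) :: real set set"
  have borel: "sets lborel = sets (sigma UNIV ?E)"
    by (simp add: borel_eq_box box_real)
  have "sets (lebesgue_Rd d) = sets (\<Pi>\<^sub>M i\<in>{..<d}. sigma UNIV ?E)"
    by (intro sets_PiM_cong borel refl)
  also have "\<dots> = sets (sigma (\<Pi>\<^sub>E i\<in>{..<d}. UNIV)
      {{f\<in>(\<Pi>\<^sub>E i\<in>{..<d}. UNIV). \<forall>i\<in>j. f i \<in> A i} | A j. j \<in> {{..<d}} \<and> A \<in> Pi j (\<lambda>_. ?E)})"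
  proof (intro sets_PiM_sigma)
    fix i :: nat
    \<comment> \<open>The lifting requires that countably many generators cover each factor; the
      intervals from \<open>- n\<close> to \<open>n\<close> do.\<close>
    have "\<exists>n::nat. - real n < x \<and> x < real n" for x
      using reals_Archimedean2[of "\<bar>x\<bar>"] by (auto simp: abs_less_iff minus_less_iff)
    then have "UNIV = (\<Union>n::nat. {- real n<..<real n})"
      by auto
    then show "\<exists>S\<subseteq>?E. countable S \<and> UNIV = \<Union>S"
      by (intro exI[of _ "range (\<lambda>n::nat. {- real n<..<real n})"]) auto
  qed auto
  also have "{{f\<in>(\<Pi>\<^sub>E i\<in>{..<d}. UNIV). \<forall>i\<in>j. f i \<in> A i} | A j. j \<in> {{..<d}} \<and> A \<in> Pi j (\<lambda>_. ?E)}
      = range (\<lambda>(a, b). open_box d a b)" (is "?L = ?R")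
  proof (intro equalityI subsetI)
    fix X assume "X \<in> ?L"
    then obtain A where A: "A \<in> {..<d} \<rightarrow> ?E" "X = {f\<in>(\<Pi>\<^sub>E i\<in>{..<d}. UNIV). \<forall>i\<in>{..<d}. f i \<in> A i}"
      by auto
    have "\<forall>i. \<exists>a b. i < d \<longrightarrow> A i = {a<..<b}"
      using A(1) by fastforce
    then obtain a b where "\<And>i. i < d \<Longrightarrow> A i = {a i<..<b i}"
      by metis
    then have "X = open_box d a b"
      unfolding A(2) open_box_def by (auto simp: PiE_iff extensional_def)
    then show "X \<in> ?R" by auto
  next
    fix X assume "X \<in> ?R"
    then obtain a b where "X = open_box d a b" by auto
    then have "X = {f\<in>(\<Pi>\<^sub>E i\<in>{..<d}. UNIV). \<forall>i\<in>{..<d}. f i \<in> {a i<..<b i}}"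
      by (simp add: open_box_def set_eq_iff PiE_iff) blast
    moreover have "(\<lambda>i. {a i<..<b i}) \<in> {..<d} \<rightarrow> ?E" by auto
    ultimately show "X \<in> ?L"
      unfolding mem_Collect_eq by (intro exI[of _ "\<lambda>i. {a i<..<b i}"] exI[of _ "{..<d}"]) blast
  qed
  finally have "sets (lebesgue_Rd d) =
      sets (sigma (\<Pi>\<^sub>E i\<in>{..<d}. UNIV) (range (\<lambda>(a, b). open_box d a b)))" .
  moreover have "range (\<lambda>(a, b). open_box d a b) \<subseteq> Pow (\<Pi>\<^sub>E i\<in>{..<d}. UNIV)"
    unfolding open_box_def by fastforce
  ultimately show ?thesis
    by (simp add: space_PiM)
qed

text \<open>Dynkin argument: the sets over which \<open>g\<close> integrates to 0 are closed under
  countable disjoint unions and, as the total integral is 0, under complements. Hence they exhaust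
  the sigma-algebra, in particular they include the sets where \<open>g\<close> is positive and
  where it is negative.\<close>

lemma AE_zero_if_integrals_zero_on_generator:
  fixes g :: "'a \<Rightarrow> real"
  assumes sets: "sets M = sigma_sets (space M) E" and E: "Int_stable E" "E \<subseteq> Pow (space M)"
    and g: "integrable M g" "(LINT x|M. g x) = 0" "\<And>A. A \<in> E \<Longrightarrow> (LINT x:A|M. g x) = 0"
  shows "AE x in M. g x = 0"
proof -
  have si: "set_integrable M A g" if "A \<in> sets M" for A
    using g(1) that unfolding set_integrable_def by (rule integrable_mult_indicator[rotated])
  have zero: "(LINT x:A|M. g x) = 0" if "A \<in> sets M" for A
    using E that[unfolded sets]
  proof (induction rule: sigma_sets_induct_disjoint)
    case (compl A)
    then have A: "A \<in> sets M" by (simp add: sets)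
    have "(LINT x:space M - A|M. g x) = (LINT x|M. g x - indicator A x *\<^sub>R g x)"
      unfolding set_lebesgue_integral_def
      by (intro Bochner_Integration.integral_cong) (auto simp: indicator_def)
    also have "\<dots> = (LINT x|M. g x) - (LINT x:A|M. g x)"
      using g(1) si[OF A] unfolding set_lebesgue_integral_def set_integrable_def
      by (rule Bochner_Integration.integral_diff)
    finally show ?case using g(2) compl by simp
  next
    case (union A)
    then have A: "A i \<in> sets M" for i by (auto simp: sets)
    have "(LINT x:(\<Union>i. A i)|M. g x) = (\<Sum>i. LINT x:A i|M. g x)"
      using union(1) A
      by (intro lebesgue_integral_countable_add si) (auto simp: disjoint_family_on_def)
    with union(3) show ?case by simp
  qed (use g in \<open>auto simp: set_lebesgue_integral_def\<close>)
  have [measurable]: "g \<in> borel_measurable M" using g(1) by simp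
  let ?P = "{x \<in> space M. 0 < g x}" and ?N = "{x \<in> space M. g x < 0}"
  have P: "?P \<in> sets M" and N: "?N \<in> sets M" by measurable
  have "AE x in M. indicator ?P x *\<^sub>R g x = 0"
    using zero[OF P] si[OF P] unfolding set_lebesgue_integral_def set_integrable_def
    by (subst (asm) integral_nonneg_eq_0_iff_AE) (auto simp: indicator_def)
  moreover have "AE x in M. - (indicator ?N x *\<^sub>R g x) = 0"
    using zero[OF N] si[OF N] unfolding set_lebesgue_integral_def set_integrable_def
    by (intro integral_nonneg_eq_0_iff_AE[THEN iffD1]) (auto simp: indicator_def)
  ultimately show ?thesis
    using AE_space by eventually_elim (auto simp: indicator_def split: if_splits)
qed

section \<open>Countable covers of open sets by boxes\<close>

lemma rational_box_neighbourhood: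
  assumes "openin (Rd d) \<Omega>" "x \<in> \<Omega>"
  obtains a b where "a \<in> {..<d} \<rightarrow>\<^sub>E \<rat>" "b \<in> {..<d} \<rightarrow>\<^sub>E \<rat>" "x \<in> open_box d a b" "closed_box d a b \<subseteq> \<Omega>"
proof -
  obtain U where U: "\<And>i. i < d \<Longrightarrow> open (U i)" "x \<in> Pi\<^sub>E {..<d} U" "Pi\<^sub>E {..<d} U \<subseteq> \<Omega>"
    using assms unfolding openin_product_topology_alt by (metis lessThan_iff open_openin)
  have "\<exists>a b. i < d \<longrightarrow> a \<in> \<rat> \<and> b \<in> \<rat> \<and> a < x i \<and> x i < b \<and> {a..b} \<subseteq> U i" for i
  proof (cases "i < d")
    case True
    then have "open (U i)" "x i \<in> U i" using U by auto
    then obtain e where e: "e > 0" "cball (x i) e \<subseteq> U i"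
      using open_contains_cball by blast
    obtain a b where "a \<in> \<rat>" "x i - e < a" "a < x i" "b \<in> \<rat>" "x i < b" "b < x i + e"
      using Rats_dense_in_real[of "x i - e" "x i"] Rats_dense_in_real[of "x i" "x i + e"] e(1)
      by auto
    moreover from this have "{a..b} \<subseteq> cball (x i) e"
      by (auto simp: dist_real_def)
    ultimately show ?thesis using e(2) by blast
  qed auto
  then obtain a b where ab: "\<And>i. i < d \<Longrightarrow> a i \<in> \<rat> \<and> b i \<in> \<rat> \<and> a i < x i \<and> x i < b i \<and> {a i..b i} \<subseteq> U i"
    by metis
  show ?thesis
  proof (rule that)
    \<comment> \<open>Restriction makes the corners extensional, so that they range over a countable
      set.\<close>
    show "restrict a {..<d} \<in> {..<d} \<rightarrow>\<^sub>E \<rat>" "restrict b {..<d} \<in> {..<d} \<rightarrow>\<^sub>E \<rat>"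
      using ab by auto
    show "x \<in> open_box d (restrict a {..<d}) (restrict b {..<d})"
      using ab U(2) by (auto simp: open_box_def PiE_iff)
    have "closed_box d (restrict a {..<d}) (restrict b {..<d}) \<subseteq> Pi\<^sub>E {..<d} U"
      unfolding closed_box_def using ab by (intro PiE_mono) auto
    then show "closed_box d (restrict a {..<d}) (restrict b {..<d}) \<subseteq> \<Omega>"
      using U(3) by blast
  qed
qed

text \<open>The boxes with rational corners whose closure stays in \<open>\<Omega>\<close> suffice.
  Containment of the compact closed box is kept because local integrability and the bump functions
  need it.\<close>

lemma openin_countable_Union_boxes:
  assumes "openin (Rd d) \<Omega>"
  obtains C where "countable C" "\<And>a b. (a, b) \<in> C \<Longrightarrow> closed_box d a b \<subseteq> \<Omega>"
    "\<Omega> = (\<Union>(a, b)\<in>C. open_box d a b)"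
proof -
  let ?R = "{..<d} \<rightarrow>\<^sub>E \<rat> :: (nat \<Rightarrow> real) set"
  let ?C = "{(a, b) \<in> ?R \<times> ?R. closed_box d a b \<subseteq> \<Omega>}"
  have "countable ?R"
    by (intro countable_PiE) (auto simp: countable_rat)
  then have "countable ?C"
    by (intro countable_subset[of ?C "?R \<times> ?R"] countable_SIGMA) auto
  moreover have "\<And>a b. (a, b) \<in> ?C \<Longrightarrow> closed_box d a b \<subseteq> \<Omega>" by auto
  moreover have "\<Omega> = (\<Union>(a, b)\<in>?C. open_box d a b)"
  proof (intro equalityI subsetI)
    fix x assume "x \<in> \<Omega>"
    obtain a b where "a \<in> ?R" "b \<in> ?R" and x: "x \<in> open_box d a b" and "closed_box d a b \<subseteq> \<Omega>"
      by (rule rational_box_neighbourhood[OF assms \<open>x \<in> \<Omega>\<close>]) (rule that)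
    then have "(a, b) \<in> ?C" by simp
    with x show "x \<in> (\<Union>(a, b)\<in>?C. open_box d a b)" by blast
  next
    fix x assume "x \<in> (\<Union>(a, b)\<in>?C. open_box d a b)"
    then obtain a b where "closed_box d a b \<subseteq> \<Omega>" "x \<in> open_box d a b" by auto
    then show "x \<in> \<Omega>" using open_box_subset_closed_box[of d a b] by auto
  qed
  ultimately show thesis by (rule that)
qed

lemma sets_openin:
  assumes "openin (Rd d) \<Omega>"
  shows "\<Omega> \<in> sets (lebesgue_Rd d)"
proof -
  obtain C where "countable C" "\<And>a b. (a, b) \<in> C \<Longrightarrow> closed_box d a b \<subseteq> \<Omega>"
    "\<Omega> = (\<Union>(a, b)\<in>C. open_box d a b)"
    by (rule openin_countable_Union_boxes[OF assms]) (rule that)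
  then show ?thesis by (auto intro!: sets.countable_UN')
qed

text \<open>A countable union of null sets is null, so an almost everywhere statement on
  \<open>\<Omega>\<close> reduces to single boxes with closure in \<open>\<Omega>\<close>.\<close>

lemma AE_vol_openI:
  assumes "openin (Rd d) \<Omega>"
    and "\<And>a b. closed_box d a b \<subseteq> \<Omega> \<Longrightarrow> AE x in lebesgue_Rd d. x \<in> open_box d a b \<longrightarrow> P x"
  shows "AE x in vol d \<Omega>. P x"
proof -
  obtain C where C: "countable C" "\<And>a b. (a, b) \<in> C \<Longrightarrow> closed_box d a b \<subseteq> \<Omega>"
    "\<Omega> = (\<Union>(a, b)\<in>C. open_box d a b)"
    by (rule openin_countable_Union_boxes[OF assms(1)]) (rule that)
  have "AE x in lebesgue_Rd d. \<forall>(a, b)\<in>C. x \<in> open_box d a b \<longrightarrow> P x"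
    using assms(2) C(1,2) by (subst AE_ball_countable) auto
  then have "AE x in lebesgue_Rd d. x \<in> \<Omega> \<longrightarrow> P x"
    unfolding C(3) by eventually_elim auto
  then show ?thesis
    unfolding vol_def using sets_openin[OF assms(1)] by (subst AE_restrict_space_iff) auto
qed

section \<open>The fundamental lemma of the calculus of variations\<close>

lemma closed_box_compactin: "compactin (Rd d) (closed_box d a b)"
  by (simp add: closed_box_def compactin_PiE)

lemma flat_exp_measurable [measurable]: "flat_exp n \<in> borel_measurable borel"
  by (intro borel_measurable_continuous_onI continuous_at_imp_continuous_on ballI
      DERIV_isCont[OF flat_exp_has_derivative])

lemma box_bump_measurable [measurable]: "box_bump d a b k \<in> borel_measurable (lebesgue_Rd d)"
  unfolding box_bump_def[abs_def]
  by (intro borel_measurable_prod borel_measurable_times measurable_compose[OF _ flat_exp_measurable]) simp_all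

lemma integrable_on_closed_box:
  assumes "locally_integrable d \<Omega> g" "closed_box d a b \<subseteq> \<Omega>"
  shows "set_integrable (lebesgue_Rd d) (closed_box d a b) g"
proof -
  have "integrable (vol d (closed_box d a b)) g"
    using assms closed_box_compactin unfolding locally_integrable_def by blast
  then show ?thesis
    unfolding vol_def set_integrable_def by (subst (asm) integrable_restrict_space) auto
qed

text \<open>Dominated convergence: the bumps lie between 0 and 1 and vanish off the closed box, so
  the absolute value of \<open>g\<close> on that box is an integrable majorant.\<close>

lemma box_bump_integral_tendsto:
  assumes \<Omega>: "openin (Rd d) \<Omega>" and g: "locally_integrable d \<Omega> g" and box: "closed_box d a b \<subseteq> \<Omega>"
  shows "(\<lambda>k. LINT x|vol d \<Omega>. g x * box_bump d a b (real k) x)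
    \<longlonglongrightarrow> (LINT x:open_box d a b|lebesgue_Rd d. g x)"
proof -
  have [measurable]: "\<Omega> \<in> sets (lebesgue_Rd d)" using \<Omega> by (rule sets_openin)
  \<comment> \<open>Measurability of \<open>g\<close> is known only on \<open>\<Omega>\<close>,
    hence the cut-off before passing to the whole space.\<close>
  have [measurable]: "(\<lambda>x. indicator \<Omega> x *\<^sub>R g x) \<in> borel_measurable (lebesgue_Rd d)"
    using g unfolding locally_integrable_def vol_def
    by (subst (asm) borel_measurable_restrict_space_iff) auto
  have zero: "box_bump d a b (real k) x = 0"
    if "x \<in> space (lebesgue_Rd d)" "x \<notin> closed_box d a b" for k x
  proof -
    have "\<exists>i<d. \<not> (a i \<le> x i \<and> x i \<le> b i)"
      using that by (simp add: space_PiM closed_box_def PiE_iff) blast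
    then obtain i where "i < d" "x i < a i \<or> b i < x i"
      by (meson not_le)
    then show ?thesis by (intro box_bump_eq_0) auto
  qed
  have "(\<lambda>k. LINT x|lebesgue_Rd d. (indicator \<Omega> x *\<^sub>R g x) * box_bump d a b (real k) x)
    \<longlonglongrightarrow> (LINT x|lebesgue_Rd d. (indicator \<Omega> x *\<^sub>R g x) * indicator (open_box d a b) x)"
  proof (rule integral_dominated_convergence[where
        w = "\<lambda>x. norm (indicator (closed_box d a b) x *\<^sub>R g x)"])
    show "integrable (lebesgue_Rd d) (\<lambda>x. norm (indicator (closed_box d a b) x *\<^sub>R g x))"
      using integrable_on_closed_box[OF g box] unfolding set_integrable_def
      by (rule integrable_norm)
    show "AE x in lebesgue_Rd d. (\<lambda>k. (indicator \<Omega> x *\<^sub>R g x) * box_bump d a b (real k) x)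
        \<longlonglongrightarrow> (indicator \<Omega> x *\<^sub>R g x) * indicator (open_box d a b) x"
      using box_bump_tendsto[of _ d a b]
      by (intro AE_I2 tendsto_mult tendsto_const) (auto simp: space_PiM PiE_iff open_box_def)
    show "AE x in lebesgue_Rd d. norm ((indicator \<Omega> x *\<^sub>R g x) * box_bump d a b (real k) x)
        \<le> norm (indicator (closed_box d a b) x *\<^sub>R g x)" for k
    proof (rule AE_I2)
      fix x assume x: "x \<in> space (lebesgue_Rd d)"
      show "norm ((indicator \<Omega> x *\<^sub>R g x) * box_bump d a b (real k) x)
        \<le> norm (indicator (closed_box d a b) x *\<^sub>R g x)"
        using zero[OF x, of k] box_bump_range[of d a b "real k" x] box
        by (auto simp: indicator_def abs_mult mult_left_le)
    qed
  qed measurable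
  moreover have "(LINT x|lebesgue_Rd d. (indicator \<Omega> x *\<^sub>R g x) * box_bump d a b (real k) x)
      = (LINT x|vol d \<Omega>. g x * box_bump d a b (real k) x)" for k
    unfolding vol_def by (subst integral_restrict_space) (auto simp: mult.assoc)
  moreover have "(LINT x|lebesgue_Rd d. (indicator \<Omega> x *\<^sub>R g x) * indicator (open_box d a b) x)
      = (LINT x:open_box d a b|lebesgue_Rd d. g x)"
    unfolding set_lebesgue_integral_def
    using open_box_subset_closed_box[of d a b] box
    by (intro Bochner_Integration.integral_cong) (auto simp: indicator_def)
  ultimately show ?thesis by simp
qed

text \<open>Testing with bumps and passing to the limit gives equal integrals over all boxes with
  closure in \<open>\<Omega>\<close>. As boxes generate the Borel sets, the two functions agree
  almost everywhere on each such box.\<close>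

lemma AE_eq_if_test_integrals_eq:
  assumes \<Omega>: "openin (Rd d) \<Omega>" and g: "locally_integrable d \<Omega> g" and h: "locally_integrable d \<Omega> h"
    and eq: "\<And>\<phi>. test_function d \<Omega> \<phi> \<Longrightarrow> (LINT x|vol d \<Omega>. g x * \<phi> x) = (LINT x|vol d \<Omega>. h x * \<phi> x)"
  shows "AE x in vol d \<Omega>. g x = h x"
proof (rule AE_vol_openI[OF \<Omega>])
  fix a b assume ab: "closed_box d a b \<subseteq> \<Omega>"
  let ?Q = "open_box d a b" and ?M = "lebesgue_Rd d"
  let ?F = "\<lambda>x. indicator ?Q x *\<^sub>R (g x - h x)"
  have si: "set_integrable ?M (open_box d a' b') f"
    if "locally_integrable d \<Omega> f" "closed_box d a' b' \<subseteq> \<Omega>" for f a' b'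
    by (rule set_integrable_subset[OF integrable_on_closed_box[OF that]])
      (auto intro: open_box_subset_closed_box[THEN subsetD])
  have zero: "(LINT x:open_box d a' b'|?M. g x - h x) = 0"
    if "closed_box d a' b' \<subseteq> \<Omega>" for a' b'
  proof -
    have "test_function d \<Omega> (box_bump d a' b' (real k))" for k
      using that by (intro box_bump_test_function) (auto simp: closed_box_def)
    from eq[OF this] have "(LINT x:open_box d a' b'|?M. g x) = (LINT x:open_box d a' b'|?M. h x)"
      using box_bump_integral_tendsto[OF \<Omega> g that] box_bump_integral_tendsto[OF \<Omega> h that]
      by (simp add: LIMSEQ_unique)
    then show ?thesis
      using si[OF g that] si[OF h that] by simp
  qed
  \<comment> \<open>Cutting off to \<open>?Q\<close> makes the difference globally integrable. Its
    integral over any box is one over the intersection with \<open>?Q\<close>, again a box with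
    closure in \<open>\<Omega>\<close>.\<close>
  have "AE x in ?M. ?F x = 0"
  proof (rule AE_zero_if_integrals_zero_on_generator[OF sets_lebesgue_Rd_eq_boxes])
    show "Int_stable (range (\<lambda>(a, b). open_box d a b))"
      by (auto simp: Int_stable_def open_box_Int)
    show "range (\<lambda>(a, b). open_box d a b) \<subseteq> Pow (space ?M)"
      using sets.sets_into_space[OF sets_open_box] by auto
    show "integrable ?M ?F"
      using set_integral_diff(1)[OF si[OF g ab] si[OF h ab]] by (simp add: set_integrable_def)
    show "(LINT x|?M. ?F x) = 0"
      using zero[OF ab] by (simp add: set_lebesgue_integral_def)
    fix A assume "A \<in> range (\<lambda>(a, b). open_box d a b)"
    then obtain a' b' where A: "A = open_box d a' b'" by auto
    have "(LINT x:A|?M. ?F x) = (LINT x:A \<inter> ?Q|?M. g x - h x)"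
      unfolding set_lebesgue_integral_def
      by (intro Bochner_Integration.integral_cong) (auto simp: indicator_def)
    also have "\<dots> = 0"
      unfolding A open_box_Int
      by (intro zero order_trans[OF closed_box_mono ab]) auto
    finally show "(LINT x:A|?M. ?F x) = 0" .
  qed
  then show "AE x in ?M. x \<in> ?Q \<longrightarrow> g x = h x"
    by eventually_elim (auto simp: indicator_def)
qed

lemma weak_gradient_AE_unique:
  assumes \<Omega>: "openin (Rd d) \<Omega>" and G: "has_weak_gradient d \<Omega> u G" and H: "has_weak_gradient d \<Omega> u H"
    and "i < d"
  shows "AE x in vol d \<Omega>. G x i = H x i"
proof (rule AE_eq_if_test_integrals_eq[OF \<Omega>, of "\<lambda>x. G x i" "\<lambda>x. H x i"])
  show "locally_integrable d \<Omega> (\<lambda>x. G x i)" "locally_integrable d \<Omega> (\<lambda>x. H x i)"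
    using G H \<open>i < d\<close> by (simp_all add: has_weak_gradient_def)
  fix \<phi> assume "test_function d \<Omega> \<phi>"
  then show "(LINT x|vol d \<Omega>. G x i * \<phi> x) = (LINT x|vol d \<Omega>. H x i * \<phi> x)"
    using G H \<open>i < d\<close> by (auto simp: has_weak_gradient_def)
qed

text \<open>\<open>W1\<close> provides some square integrable gradient, whereas
  \<open>weak_gradient\<close> is an arbitrary choice; almost everywhere uniqueness carries the
  integrability over.\<close>

lemma W1_weak_gradient_square_integrable:
  assumes \<Omega>: "openin (Rd d) \<Omega>" and u: "u \<in> W1 d 2 \<Omega>" and "i < d"
  shows "(\<lambda>x. weak_gradient d \<Omega> u x i) \<in> borel_measurable (vol d \<Omega>)"
    and "integrable (vol d \<Omega>) (\<lambda>x. (weak_gradient d \<Omega> u x i)\<^sup>2)"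
proof -
  have "\<exists>G. has_weak_gradient d \<Omega> u G \<and> (\<forall>i<d. (\<lambda>x. G x i) \<in> Lebesgue_space d 2 \<Omega>)"
    using u by (simp add: W1_def)
  then obtain G where "has_weak_gradient d \<Omega> u G \<and> (\<forall>i<d. (\<lambda>x. G x i) \<in> Lebesgue_space d 2 \<Omega>)" ..
  with \<open>i < d\<close> have G: "has_weak_gradient d \<Omega> u G" "(\<lambda>x. G x i) \<in> Lebesgue_space d 2 \<Omega>"
    by simp_all
  from G(1) have W: "has_weak_gradient d \<Omega> u (weak_gradient d \<Omega> u)"
    unfolding weak_gradient_def by (rule someI[of "has_weak_gradient d \<Omega> u"])
  with \<open>i < d\<close> show [measurable]: "(\<lambda>x. weak_gradient d \<Omega> u x i) \<in> borel_measurable (vol d \<Omega>)"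
    by (simp add: has_weak_gradient_def locally_integrable_def)
  have [measurable]: "(\<lambda>x. G x i) \<in> borel_measurable (vol d \<Omega>)"
    and "integrable (vol d \<Omega>) (\<lambda>x. (G x i)\<^sup>2)"
    using G(2) by (auto simp: Lebesgue_space_def)
  moreover have "AE x in vol d \<Omega>. (G x i)\<^sup>2 = (weak_gradient d \<Omega> u x i)\<^sup>2"
    using weak_gradient_AE_unique[OF \<Omega> G(1) W \<open>i < d\<close>] by eventually_elim simp
  ultimately show "integrable (vol d \<Omega>) (\<lambda>x. (weak_gradient d \<Omega> u x i)\<^sup>2)"
    by (subst (asm) integrable_cong_AE) auto
qed

text \<open>A bounded set lies in a cube. Finite measure is needed for the energy since
  \<open>kappa\<close> stays bounded below by a positive constant even where the gradient
  vanishes.\<close>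

lemma finite_measure_vol:
  assumes "bounded_open d \<Omega>"
  shows "finite_measure (vol d \<Omega>)"
proof -
  interpret finite_product_sigma_finite "\<lambda>_. lborel :: real measure" "{..<d}"
    by standard auto
  have \<Omega>: "openin (Rd d) \<Omega>" "\<exists>B. \<forall>x\<in>\<Omega>. L2_set x {..<d} \<le> B"
    using assms by (simp_all add: bounded_open_def)
  from \<Omega>(2) obtain B where B: "\<forall>x\<in>\<Omega>. L2_set x {..<d} \<le> B" ..
  have "\<Omega> \<subseteq> closed_box d (\<lambda>_. - B) (\<lambda>_. B)"
  proof
    fix x assume x: "x \<in> \<Omega>"
    have "x \<in> extensional {..<d}"
      using openin_subset[OF \<Omega>(1)] x by (auto simp: PiE_def)
    moreover have "\<bar>x i\<bar> \<le> B" if "i < d" for i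
      using member_le_L2_set[of "{..<d}" i "\<lambda>i. \<bar>x i\<bar>"] bspec[OF B x] that
      by (simp add: L2_set_def)
    ultimately show "x \<in> closed_box d (\<lambda>_. - B) (\<lambda>_. B)"
      by (auto simp: closed_box_def PiE_iff abs_le_iff minus_le_iff)
  qed
  then have "emeasure (lebesgue_Rd d) \<Omega> \<le> emeasure (lebesgue_Rd d) (closed_box d (\<lambda>_. - B) (\<lambda>_. B))"
    by (intro emeasure_mono) auto
  also have "\<dots> < \<infinity>"
    unfolding closed_box_def by (subst measure_times) (auto simp: power_less_top_ennreal emeasure_lborel_Icc_eq)
  finally show ?thesis
    using sets_openin[OF \<Omega>(1)] sets.sets_into_space[OF sets_openin[OF \<Omega>(1)]]
    by (intro finite_measureI) (auto simp: vol_def space_restrict_space emeasure_restrict_space Int_absorb2)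
qed

subsection \<open>Inequalities for the relaxed integrand\<close>

text \<open>Serves the transition points of \<open>kappa\<close>, where the left and the right
  derivative come from different branches.\<close>

lemma has_real_derivative_from_sides:
  fixes f :: "real \<Rightarrow> real"
  assumes "(f has_real_derivative D) (at x within {..x})" "(f has_real_derivative D) (at x within {x..})"
  shows "(f has_real_derivative D) (at x)"
proof -
  have "{..x} \<union> {x..} = (UNIV :: real set)" by auto
  then have at: "at x = sup (at x within {..x}) (at x within {x..})"
    by (metis at_within_union)
  have "((\<lambda>y. (f y - f x) / (y - x)) \<longlongrightarrow> D) (at x)"
    using assms unfolding at by (simp add: has_field_derivative_iff filterlim_sup)
  then show ?thesis
    by (simp add: has_field_derivative_iff)
qed

context
  fixes p em ep :: real
  assumes p: "1 < p" "p < 2" and em: "0 < em" and emep: "em \<le> ep"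
begin

definition weight :: "real \<Rightarrow> real" where
  "weight t = clamp_to em ep t powr (p - 2)"

text \<open>The least slope of \<open>weight t * t\<close> for \<open>t \<ge> 0\<close>: between
  \<open>em\<close> and \<open>ep\<close> the slope is \<open>(p - 1) * t powr (p - 2)\<close>,
  smallest at \<open>ep\<close>; on the outer branches it is at least
  \<open>ep powr (p - 2)\<close>.\<close>

definition ellipticity :: real where
  "ellipticity = (p - 1) * ep powr (p - 2)"

lemma weight_antimono: "s \<le> t \<Longrightarrow> weight t \<le> weight s"
  unfolding weight_def clamp_to_def using p em emep by (intro powr_mono2') auto

lemma weight_le: "weight t \<le> em powr (p - 2)"
  unfolding weight_def clamp_to_def using p em emep by (intro powr_mono2') auto

lemma ellipticity_pos: "0 < ellipticity"
  unfolding ellipticity_def using p em emep by simp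

lemma ellipticity_le_weight: "ellipticity \<le> weight t"
proof -
  have "ellipticity \<le> 1 * ep powr (p - 2)"
    unfolding ellipticity_def using p by (intro mult_right_mono) auto
  also have "\<dots> \<le> weight t"
    unfolding weight_def clamp_to_def using p em emep by (simp, intro powr_mono2') auto
  finally show ?thesis .
qed

lemma weight_pos: "0 < weight t"
  using ellipticity_pos ellipticity_le_weight[of t] by linarith

lemma powr_minus_2_mult_square: "0 < x \<Longrightarrow> x powr (p - 2) * x\<^sup>2 = x powr p"
  by (simp add: powr_diff)

lemma kappa_has_derivative: "(kappa p em ep has_real_derivative weight t * t) (at t)"
proof -
  let ?q = "\<lambda>c t. 1/2 * c powr (p - 2) * t\<^sup>2 + (1/p - 1/2) * c powr p"
  let ?m = "\<lambda>t. 1/p * t powr p"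
  have q: "(?q c has_real_derivative c powr (p - 2) * t) (at t within S)" for c t S
    by (auto intro!: derivative_eq_intros)
  have m: "(?m has_real_derivative t powr (p - 2) * t) (at t within S)" if "t > 0" for t S
  proof -
    have "(?m has_real_derivative 1/p * (p * t powr (p - 1))) (at t)"
      using that by (intro DERIV_cmult has_real_derivative_powr)
    moreover have "1/p * (p * t powr (p - 1)) = t powr (p - 2) * t"
      using that p by (simp add: powr_diff power2_eq_square)
    ultimately show ?thesis by (metis has_field_derivative_at_within)
  qed
  \<comment> \<open>The additive constants in \<open>kappa\<close> are exactly those that make the
    quadratic branches meet the power branch.\<close>
  have qm: "?q c c = ?m c" if "c > 0" for c
    using powr_minus_2_mult_square[OF that] by (simp add: algebra_simps)
  have k1: "kappa p em ep x = ?q em x" if "x \<le> em" for x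
    using that by (simp add: kappa_def)
  have k2: "kappa p em ep x = ?m x" if "em \<le> x" "x \<le> ep" for x
    using that qm[OF em] by (cases "x = em") (simp_all add: kappa_def)
  have k3: "kappa p em ep x = ?q ep x" if "ep \<le> x" for x
  proof (cases "x = ep")
    case True
    then show ?thesis using k2[of ep] qm[of ep] em emep by simp
  qed (use that emep in \<open>simp add: kappa_def\<close>)
  have "(kappa p em ep has_real_derivative weight t * t) (at t within {..t})"
  proof -
    \<comment> \<open>In each case \<open>d\<close> is the distance from \<open>t\<close> down to
      the next transition point, within which one branch is valid. On the lowest branch there is
      none, and \<open>d = 1\<close> is an arbitrary choice.\<close>
    consider "t \<le> em" | "em < t" "t \<le> ep" | "ep < t" by linarith
    then show ?thesis
    proof cases
      case 1
      then have "weight t = em powr (p - 2)" using emep by (simp add: weight_def clamp_to_def)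
      with q[of em t "{..t}"] show ?thesis
        by (rule_tac has_field_derivative_transform_within[where f = "?q em" and d = 1])
          (use 1 k1 in auto)
    next
      case 2
      then have "weight t = t powr (p - 2)" by (simp add: weight_def clamp_to_def)
      with m[of t "{..t}"] 2 em show ?thesis
        by (rule_tac has_field_derivative_transform_within[where f = ?m and d = "t - em"])
          (use k2 in \<open>auto simp: dist_real_def\<close>)
    next
      case 3
      then have "weight t = ep powr (p - 2)" using emep by (simp add: weight_def clamp_to_def)
      with q[of ep t "{..t}"] show ?thesis
        by (rule_tac has_field_derivative_transform_within[where f = "?q ep" and d = "t - ep"])
          (use 3 k3 in \<open>auto simp: dist_real_def\<close>)
    qed
  qed
  moreover have "(kappa p em ep has_real_derivative weight t * t) (at t within {t..})"
  proof -
    consider "t < em" | "em \<le> t" "t < ep" | "ep \<le> t" by linarith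
    then show ?thesis
    proof cases
      case 1
      then have "weight t = em powr (p - 2)" using emep by (simp add: weight_def clamp_to_def)
      with q[of em t "{t..}"] show ?thesis
        by (rule_tac has_field_derivative_transform_within[where f = "?q em" and d = "em - t"])
          (use 1 k1 in \<open>auto simp: dist_real_def\<close>)
    next
      case 2
      then have "weight t = t powr (p - 2)" by (simp add: weight_def clamp_to_def)
      with m[of t "{t..}"] 2 em show ?thesis
        by (rule_tac has_field_derivative_transform_within[where f = ?m and d = "ep - t"])
          (use k2 in \<open>auto simp: dist_real_def\<close>)
    next
      case 3
      then have "weight t = ep powr (p - 2)" using emep by (simp add: weight_def clamp_to_def)
      with q[of ep t "{t..}"] show ?thesis
        by (rule_tac has_field_derivative_transform_within[where f = "?q ep" and d = 1])
          (use 3 k3 in auto)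
    qed
  qed
  ultimately show ?thesis by (rule has_real_derivative_from_sides)
qed

text \<open>\<open>h\<close> decreases up to \<open>s\<close> and increases afterwards. Both the
  upper and the lower quadratic bound for \<open>kappa\<close> follow from this applied to a
  difference.\<close>

lemma minimum_if_derivative_changes_sign:
  fixes h h' :: "real \<Rightarrow> real"
  assumes h: "\<And>x. (h has_real_derivative h' x) (at x)"
    and le: "\<And>x. 0 \<le> x \<Longrightarrow> x \<le> s \<Longrightarrow> h' x \<le> 0" and ge: "\<And>x. s \<le> x \<Longrightarrow> 0 \<le> h' x"
    and "0 \<le> t"
  shows "h s \<le> h t"
proof (cases "t \<le> s")
  case True
  then show ?thesis
    using h le \<open>0 \<le> t\<close> by (intro DERIV_nonpos_imp_nonincreasing[of t s h]) (meson order_trans)+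
next
  case False
  then show ?thesis
    using h ge by (intro DERIV_nonneg_imp_nondecreasing[of s t h]) (simp, meson)
qed

text \<open>As \<open>p < 2\<close>, \<open>kappa\<close> is a concave function of the square of its argument.\<close>

lemma kappa_le_quadratic:
  assumes "0 \<le> s" "0 \<le> t"
  shows "kappa p em ep t \<le> kappa p em ep s + weight s / 2 * (t\<^sup>2 - s\<^sup>2)"
proof -
  let ?h = "\<lambda>x. weight s / 2 * x\<^sup>2 - kappa p em ep x"
  have "?h s \<le> ?h t"
  proof (rule minimum_if_derivative_changes_sign[where h = ?h and h' = "\<lambda>x. (weight s - weight x) * x"])
    show "(?h has_real_derivative (weight s - weight x) * x) (at x)" for x
      by (auto intro!: derivative_eq_intros kappa_has_derivative simp: algebra_simps)
    show "(weight s - weight x) * x \<le> 0" if "0 \<le> x" "x \<le> s" for x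
      using weight_antimono[OF that(2)] that(1) by (intro mult_nonpos_nonneg) auto
    show "0 \<le> (weight s - weight x) * x" if "s \<le> x" for x
      using weight_antimono[OF that] that assms(1) by (intro mult_nonneg_nonneg) auto
  qed fact
  then show ?thesis by (simp add: algebra_simps)
qed

text \<open>On the two outer ranges the weight is constant and at least \<open>ellipticity\<close>,
  so the function is linear with nonnegative slope; in between its derivative is nonnegative by the
  choice of \<open>ellipticity\<close>.\<close>

lemma weight_ellipticity_mono:
  assumes "0 \<le> s" "s \<le> t"
  shows "(weight s - ellipticity) * s \<le> (weight t - ellipticity) * t"
proof -
  let ?b = "\<lambda>t. (weight t - ellipticity) * t"
  have const: "?b x \<le> ?b y" if "weight x = weight y" "x \<le> y" for x y
    using that ellipticity_le_weight[of y] by (auto intro: mult_left_mono)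
  have 1: "?b x \<le> ?b y" if "x \<le> y" "y \<le> em" for x y
    using that emep by (intro const) (auto simp: weight_def clamp_to_def)
  have 3: "?b x \<le> ?b y" if "x \<le> y" "ep \<le> x" for x y
    using that emep by (intro const) (auto simp: weight_def clamp_to_def)
  have 2: "?b x \<le> ?b y" if xy: "em \<le> x" "x \<le> y" "y \<le> ep" for x y
  proof -
    let ?c = "\<lambda>t. t powr (p - 1) - ellipticity * t"
    have b: "?b z = ?c z" if "em \<le> z" "z \<le> ep" for z
    proof -
      have "z powr (p - 1) = z powr (p - 2) * z"
        using that em by (simp add: powr_diff power2_eq_square)
      then show ?thesis using that by (simp add: weight_def clamp_to_def algebra_simps)
    qed
    have "?c x \<le> ?c y"
    proof (rule DERIV_nonneg_imp_nondecreasing[OF xy(2)])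
      fix z assume z: "x \<le> z" "z \<le> y"
      then have "z > 0" using xy em by linarith
      then have "(?c has_real_derivative (p - 1) * z powr (p - 1 - 1) - ellipticity * 1) (at z)"
        by (intro DERIV_diff DERIV_cmult has_real_derivative_powr DERIV_ident)
      moreover have "ellipticity \<le> (p - 1) * z powr (p - 1 - 1)"
        unfolding ellipticity_def using p z xy \<open>z > 0\<close>
        by (intro mult_left_mono) (auto intro: powr_mono2')
      ultimately show "\<exists>D. (?c has_real_derivative D) (at z) \<and> 0 \<le> D" by force
    qed
    then show ?thesis using b xy by simp
  qed
  show ?thesis
    \<comment> \<open>Monotonicity is chained through \<open>em\<close> and \<open>ep\<close> for
      every position of \<open>s\<close> and \<open>t\<close>.\<close>
    using 1[of s t] 1[of s em] 2[of em t] 2[of em ep] 2[of s t] 2[of s ep] 3[of ep t] 3[of s t]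
      assms emep by linarith
qed

text \<open>Subtracting \<open>ellipticity / 2 * x\<^sup>2\<close> leaves a function with
  nondecreasing derivative on the half-line, which therefore lies above its tangent at
  \<open>s\<close>.\<close>

lemma kappa_strongly_convex:
  assumes "0 \<le> s" "0 \<le> t"
  shows "kappa p em ep s + weight s * s * (t - s) + ellipticity / 2 * (t - s)\<^sup>2 \<le> kappa p em ep t"
proof -
  let ?b = "\<lambda>t. (weight t - ellipticity) * t"
  let ?h = "\<lambda>x. kappa p em ep x - ellipticity / 2 * x\<^sup>2 - ?b s * x"
  have "?h s \<le> ?h t"
  proof (rule minimum_if_derivative_changes_sign[where h = ?h and h' = "\<lambda>x. ?b x - ?b s"])
    show "(?h has_real_derivative ?b x - ?b s) (at x)" for x
      by (auto intro!: derivative_eq_intros kappa_has_derivative simp: algebra_simps)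
  qed (use weight_ellipticity_mono assms in auto)
  then show ?thesis by (simp add: algebra_simps power2_eq_square add_divide_distrib)
qed

lemma kappa_nonneg: "0 \<le> kappa p em ep t"
proof -
  have "0 \<le> 1 / p - 1 / 2" using p by (simp add: field_simps)
  then show ?thesis
    unfolding kappa_def using p by (auto intro!: add_nonneg_nonneg mult_nonneg_nonneg)
qed

section \<open>Pointwise comparison of energy decrease and energy excess\<close>

lemma L2_set_square: "(L2_set x {..<d})\<^sup>2 = dot d x x"
  by (simp add: L2_set_def dot_def sum_nonneg power2_eq_square)

lemma dot_le_L2_set: "dot d x y \<le> L2_set x {..<d} * L2_set y {..<d}"
proof -
  have "dot d x y \<le> (\<Sum>i<d. \<bar>x i\<bar> * \<bar>y i\<bar>)"
    unfolding dot_def by (intro sum_mono) (metis abs_ge_self abs_mult)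
  also have "\<dots> \<le> L2_set x {..<d} * L2_set y {..<d}"
    by (rule L2_set_mult_ineq)
  finally show ?thesis .
qed

text \<open>The claim at the level of integrands, with the functional \<open>f\<close> already
  replaced by the weighted product with \<open>B\<close>. Excess and decrease are both compared with
  the squared distance of \<open>A\<close> and \<open>B\<close>.\<close>

lemma kacanov_decay_pointwise:
  fixes A B C :: "nat \<Rightarrow> real" and d :: nat
  defines "\<kappa> \<equiv> \<lambda>x. kappa p em ep (L2_set x {..<d})" and "a \<equiv> weight (L2_set A {..<d})"
  shows "(p - 1) * (em / ep) powr (2 - p) * (\<kappa> A - \<kappa> C - (a * dot d B A - a * dot d B C))
    \<le> \<kappa> A - \<kappa> B - (a * dot d B A - a * dot d B B)"
proof -
  let ?D = "\<Sum>i<d. (A i - B i)\<^sup>2" and ?l = ellipticity and ?m = "em powr (p - 2)"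
  let ?s = "L2_set A {..<d}" and ?t = "L2_set C {..<d}"
  have D: "?D = dot d A A - 2 * dot d B A + dot d B B"
    unfolding dot_def by (simp add: power2_eq_square algebra_simps sum.distrib sum_subtractf sum_distrib_left)
  have E: "(\<Sum>i<d. (A i - C i)\<^sup>2) = dot d A A - 2 * dot d A C + dot d C C"
    unfolding dot_def by (simp add: power2_eq_square algebra_simps sum.distrib sum_subtractf sum_distrib_left)
  have F: "(\<Sum>i<d. (A i - B i) * (A i - C i)) = dot d A A - dot d A C - dot d B A + dot d B C"
    unfolding dot_def by (simp add: algebra_simps sum.distrib sum_subtractf)
  \<comment> \<open>Together with the linear terms, this makes the decrease at least
    \<open>a / 2 * ?D\<close>.\<close>
  have B: "\<kappa> B \<le> \<kappa> A + a / 2 * (dot d B B - dot d A A)"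
    using kappa_le_quadratic[of ?s "L2_set B {..<d}"]
    by (simp add: \<kappa>_def a_def L2_set_square L2_set_nonneg)
  \<comment> \<open>Strong convexity is available only in the norms \<open>?s\<close> and
    \<open>?t\<close>. Since \<open>a - ?l\<close> is nonnegative, Cauchy-Schwarz turns the product
    of norms into \<open>dot d A C\<close> and gives the vector version.\<close>
  have "(a - ?l) * dot d A C \<le> (a - ?l) * (?s * ?t)"
    using ellipticity_le_weight[of ?s] dot_le_L2_set[of d A C]
    by (intro mult_left_mono) (auto simp: a_def)
  then have "a * dot d A C - ?l * dot d A C \<le> a * (?s * ?t) - ?l * (?s * ?t)"
    by (simp only: left_diff_distrib)
  moreover have "\<kappa> A + (a * (?s * ?t) - a * dot d A A)
      + (?l / 2 * dot d C C + ?l / 2 * dot d A A - ?l * (?s * ?t)) \<le> \<kappa> C"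
  proof -
    have "a * ?s * (?t - ?s) = a * (?s * ?t) - a * dot d A A"
      by (simp add: algebra_simps power2_eq_square flip: L2_set_square)
    moreover have "?l / 2 * (?t - ?s)\<^sup>2 = ?l / 2 * dot d C C + ?l / 2 * dot d A A - ?l * (?s * ?t)"
      by (simp add: algebra_simps power2_eq_square flip: L2_set_square)
    ultimately show ?thesis
      using kappa_strongly_convex[of ?s ?t] by (simp only: \<kappa>_def a_def L2_set_nonneg)
  qed
  ultimately have C: "\<kappa> A - \<kappa> C \<le> a * (dot d A A - dot d A C) - ?l / 2 * (\<Sum>i<d. (A i - C i)\<^sup>2)"
    unfolding E by (simp add: algebra_simps)
  \<comment> \<open>Completing the square; \<open>y\<close> will be a component of
    \<open>A - C\<close>, whose square is supplied by strong convexity.\<close>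
  have young: "a * (x * y) - ?l / 2 * y\<^sup>2 \<le> a\<^sup>2 / (2 * ?l) * x\<^sup>2" for x y
  proof -
    have "0 \<le> (a * x - ?l * y)\<^sup>2 / (2 * ?l)"
      using ellipticity_pos by simp
    also have "\<dots> = a\<^sup>2 / (2 * ?l) * x\<^sup>2 - a * (x * y) + ?l / 2 * y\<^sup>2"
      using ellipticity_pos by (simp add: field_simps power2_eq_square)
    finally show ?thesis by simp
  qed
  have "\<kappa> A - \<kappa> C - (a * dot d B A - a * dot d B C)
      \<le> a * (\<Sum>i<d. (A i - B i) * (A i - C i)) - ?l / 2 * (\<Sum>i<d. (A i - C i)\<^sup>2)"
    using C unfolding F by (simp add: algebra_simps)
  also have "\<dots> = (\<Sum>i<d. a * ((A i - B i) * (A i - C i)) - ?l / 2 * (A i - C i)\<^sup>2)"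
    by (simp add: sum_subtractf sum_distrib_left)
  also have "\<dots> \<le> (\<Sum>i<d. a\<^sup>2 / (2 * ?l) * (A i - B i)\<^sup>2)"
    by (intro sum_mono young)
  also have "\<dots> = a\<^sup>2 / (2 * ?l) * ?D"
    by (simp add: sum_distrib_left)
  \<comment> \<open>The factor \<open>?l / ?m\<close> cancels \<open>?l\<close> and leaves
    \<open>a / ?m\<close>, which is at most 1, in front of the lower bound for the decrease.\<close>
  finally have "?l / ?m * (\<kappa> A - \<kappa> C - (a * dot d B A - a * dot d B C)) \<le> ?l / ?m * (a\<^sup>2 / (2 * ?l) * ?D)"
    using ellipticity_pos by (intro mult_left_mono) auto
  also have "\<dots> = a / ?m * (a / 2 * ?D)"
    using ellipticity_pos by (simp add: power2_eq_square)
  also have "\<dots> \<le> 1 * (a / 2 * ?D)"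
    using weight_le[of ?s] weight_pos[of ?s] em
    by (intro mult_right_mono) (auto simp: a_def sum_nonneg)
  also have "\<dots> \<le> \<kappa> A - \<kappa> B - (a * dot d B A - a * dot d B B)"
    using B unfolding D by (simp add: algebra_simps)
  also have "?l / ?m = (p - 1) * (em / ep) powr (2 - p)"
  proof -
    have "(em / ep) powr (2 - p) = ep powr (p - 2) / em powr (p - 2)"
      using powr_minus_divide[of em "p - 2"] powr_minus_divide[of ep "p - 2"] em emep
      by (simp add: powr_divide)
    then show ?thesis by (simp add: ellipticity_def)
  qed
  finally show ?thesis .
qed

section \<open>Integrability and the energy estimate\<close>

lemma kappa_measurable [measurable]: "kappa p em ep \<in> borel_measurable borel"
  by (intro borel_measurable_continuous_onI continuous_at_imp_continuous_on ballI
      DERIV_isCont[OF kappa_has_derivative])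

lemma weight_measurable [measurable]: "weight \<in> borel_measurable borel"
  unfolding weight_def[abs_def] clamp_to_def by measurable

text \<open>The majorant is \<open>kappa_le_quadratic\<close> with base point \<open>em\<close>: a
  constant, integrable on a finite measure space, plus a multiple of the squared norm.\<close>

lemma kappa_norm_integrable:
  fixes A :: "'a \<Rightarrow> nat \<Rightarrow> real"
  assumes "finite_measure M"
    and [measurable]: "\<And>i. i < d \<Longrightarrow> (\<lambda>x. A x i) \<in> borel_measurable M"
    and A: "\<And>i. i < d \<Longrightarrow> integrable M (\<lambda>x. (A x i)\<^sup>2)"
  shows "integrable M (\<lambda>x. kappa p em ep (L2_set (A x) {..<d}))"
proof -
  interpret finite_measure M by fact
  have [measurable]: "(\<lambda>x. L2_set (A x) {..<d}) \<in> borel_measurable M"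
    unfolding L2_set_def by measurable
  have "integrable M (\<lambda>x. kappa p em ep em + weight em / 2 * ((\<Sum>i<d. (A x i)\<^sup>2) - em\<^sup>2))"
    using A by (intro Bochner_Integration.integrable_add integrable_mult_right
        Bochner_Integration.integrable_diff Bochner_Integration.integrable_sum) auto
  then show ?thesis
  proof (rule Bochner_Integration.integrable_bound)
    have "norm (kappa p em ep (L2_set y {..<d}))
        \<le> norm (kappa p em ep em + weight em / 2 * ((\<Sum>i<d. (y i)\<^sup>2) - em\<^sup>2))" for y
      using kappa_le_quadratic[of em "L2_set y {..<d}"] kappa_nonneg[of "L2_set y {..<d}"] em
        L2_set_square[of y d] by (simp add: L2_set_nonneg dot_def power2_eq_square)
    then show "AE x in M. norm (kappa p em ep (L2_set (A x) {..<d}))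
        \<le> norm (kappa p em ep em + weight em / 2 * ((\<Sum>i<d. (A x i)\<^sup>2) - em\<^sup>2))"
      by simp
  qed measurable
qed

text \<open>The weight is bounded by \<open>em powr (p - 2)\<close>, and each product of components
  by the sum of their squares.\<close>

lemma weighted_dot_integrable:
  fixes A B C :: "'a \<Rightarrow> nat \<Rightarrow> real"
  assumes [measurable]: "\<And>i. i < d \<Longrightarrow> (\<lambda>x. A x i) \<in> borel_measurable M"
      "\<And>i. i < d \<Longrightarrow> (\<lambda>x. B x i) \<in> borel_measurable M"
      "\<And>i. i < d \<Longrightarrow> (\<lambda>x. C x i) \<in> borel_measurable M"
    and B: "\<And>i. i < d \<Longrightarrow> integrable M (\<lambda>x. (B x i)\<^sup>2)"
    and C: "\<And>i. i < d \<Longrightarrow> integrable M (\<lambda>x. (C x i)\<^sup>2)"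
  shows "integrable M (\<lambda>x. weight (L2_set (A x) {..<d}) * dot d (B x) (C x))"
proof -
  have [measurable]: "(\<lambda>x. L2_set (A x) {..<d}) \<in> borel_measurable M"
    unfolding L2_set_def by measurable
  have "integrable M (\<lambda>x. weight (L2_set (A x) {..<d}) * (B x i * C x i))" if i: "i < d" for i
  proof -
    have [measurable]: "(\<lambda>x. B x i) \<in> borel_measurable M" "(\<lambda>x. C x i) \<in> borel_measurable M"
      using assms i by auto
    have "integrable M (\<lambda>x. em powr (p - 2) * ((B x i)\<^sup>2 + (C x i)\<^sup>2))"
      using B[OF i] C[OF i] by auto
    then show ?thesis
    proof (rule Bochner_Integration.integrable_bound)
      have "norm (weight s * (x * y)) \<le> norm (em powr (p - 2) * (x\<^sup>2 + y\<^sup>2))" for s x y :: real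
      proof -
        have "0 \<le> (\<bar>x\<bar> - \<bar>y\<bar>)\<^sup>2" by simp
        then have "2 * \<bar>x * y\<bar> \<le> x\<^sup>2 + y\<^sup>2" by (simp add: power2_diff abs_mult)
        then have "weight s * \<bar>x * y\<bar> \<le> em powr (p - 2) * (x\<^sup>2 + y\<^sup>2)"
          using weight_le[of s] weight_pos[of s] abs_ge_zero[of "x * y"]
          by (intro mult_mono) linarith+
        then show ?thesis
          using weight_pos[of s] by (simp add: abs_mult)
      qed
      then show "AE x in M. norm (weight (L2_set (A x) {..<d}) * (B x i * C x i))
          \<le> norm (em powr (p - 2) * ((B x i)\<^sup>2 + (C x i)\<^sup>2))"
        by simp
    qed measurable
  qed
  then show ?thesis
    unfolding dot_def sum_distrib_left by (intro Bochner_Integration.integrable_sum) auto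
qed

lemma kacanov_step_energy_decay:
  assumes \<Omega>: "bounded_open d \<Omega>" and v: "v \<in> W1_0 d 2 \<Omega>" and u: "u \<in> W1_0 d 2 \<Omega>"
    and step: "is_kacanov_step d \<Omega> p f em ep v w"
  shows "(p - 1) * (em / ep) powr (2 - p) * (energy d \<Omega> p f em ep v - energy d \<Omega> p f em ep u)
    \<le> energy d \<Omega> p f em ep v - energy d \<Omega> p f em ep w"
proof -
  let ?M = "vol d \<Omega>" and ?c = "(p - 1) * (em / ep) powr (2 - p)"
  let ?k = "\<lambda>v x. kappa p em ep (L2_set (weak_gradient d \<Omega> v x) {..<d})"
  let ?a = "\<lambda>z x. weight (L2_set (weak_gradient d \<Omega> v x) {..<d}) *
    dot d (weak_gradient d \<Omega> w x) (weak_gradient d \<Omega> z x)"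
  have op: "openin (Rd d) \<Omega>" using \<Omega> by (simp add: bounded_open_def)
  have w: "w \<in> W1_0 d 2 \<Omega>" using step by (simp add: is_kacanov_step_def)
  have W1: "z \<in> W1 d 2 \<Omega>" if "z \<in> W1_0 d 2 \<Omega>" for z
    using that by (simp add: W1_0_def)
  note L2 = W1_weak_gradient_square_integrable[OF op W1]
  have k: "integrable ?M (?k z)" if "z \<in> W1_0 d 2 \<Omega>" for z
    using L2[OF that] by (intro kappa_norm_integrable finite_measure_vol \<Omega>)
  have a: "integrable ?M (?a z)" if "z \<in> W1_0 d 2 \<Omega>" for z
    using L2[OF that] L2[OF v] L2[OF w] by (intro weighted_dot_integrable)
  \<comment> \<open>All three functions \<open>v\<close>, \<open>w\<close> and \<open>u\<close> are
    admissible in the equation for \<open>w\<close>, so each value of \<open>f\<close> in the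
    energies becomes an integral.\<close>
  have f: "f z = (LINT x|?M. ?a z x)" if "z \<in> W1_0 d 2 \<Omega>" for z
    using step that by (simp add: is_kacanov_step_def weight_def grad_norm_def)
  have diff: "energy d \<Omega> p f em ep v - energy d \<Omega> p f em ep z
      = (LINT x|?M. ?k v x - ?k z x - (?a v x - ?a z x))" if "z \<in> W1_0 d 2 \<Omega>" for z
    using k[OF v] k[OF that] a[OF v] a[OF that] f[OF v] f[OF that]
    by (simp add: energy_def grad_norm_def)
  have "?c * (LINT x|?M. ?k v x - ?k u x - (?a v x - ?a u x))
      = (LINT x|?M. ?c * (?k v x - ?k u x - (?a v x - ?a u x)))"
    by (rule integral_mult_right_zero[symmetric])
  also have "\<dots> \<le> (LINT x|?M. ?k v x - ?k w x - (?a v x - ?a w x))"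
    using k a u v w
    by (intro integral_mono integrable_mult_right Bochner_Integration.integrable_diff
        kacanov_decay_pointwise) auto
  finally show ?thesis
    using diff[OF u] diff[OF w] by simp
qed

end

theorem theorem18:
  fixes p :: real
  assumes "1 < p" and "p < 2"
  shows "\<exists>cK>1. \<forall>d\<ge>1. \<forall>\<Omega> f em ep v u.
           bounded_open d \<Omega> \<longrightarrow>
           f \<in> W1_0_dual d p \<Omega> \<longrightarrow>
           0 < em \<longrightarrow> em \<le> ep \<longrightarrow>
           v 0 \<in> W1_0 d 2 \<Omega> \<longrightarrow>
           (\<forall>n. is_kacanov_step d \<Omega> p f em ep (v n) (v (Suc n))) \<longrightarrow>
           is_energy_minimizer d \<Omega> p f em ep u \<longrightarrow>
           (\<forall>n. energy d \<Omega> p f em ep (v n) - energy d \<Omega> p f em ep (v (Suc n))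
                \<ge> (1 / cK * (em / ep) powr (2 - p)) *
                  (energy d \<Omega> p f em ep (v n) - energy d \<Omega> p f em ep u))"
proof (intro exI[of _ "1 / (p - 1)"] conjI allI impI)
  show "1 < 1 / (p - 1)" using assms by simp
  fix d \<Omega> f em ep v u n
  assume "bounded_open d \<Omega>" "0 < em" "em \<le> ep" and v0: "v 0 \<in> W1_0 d 2 \<Omega>"
    and step: "\<forall>n. is_kacanov_step d \<Omega> p f em ep (v n) (v (Suc n))"
    and "is_energy_minimizer d \<Omega> p f em ep u"
  \<comment> \<open>For \<open>n = 0\<close> this is assumed; a successor is the result of a step,
    whose definition includes membership.\<close>
  moreover have "v n \<in> W1_0 d 2 \<Omega>"
  proof (cases n)
    case (Suc m)
    then show ?thesis using spec[OF step, of m] by (simp add: is_kacanov_step_def)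
  qed (use v0 in simp)
  ultimately show "energy d \<Omega> p f em ep (v n) - energy d \<Omega> p f em ep (v (Suc n))
      \<ge> (1 / (1 / (p - 1)) * (em / ep) powr (2 - p)) *
        (energy d \<Omega> p f em ep (v n) - energy d \<Omega> p f em ep u)"
    using kacanov_step_energy_decay[OF assms, of em ep d \<Omega> "v n" u f "v (Suc n)"]
    by (simp add: is_energy_minimizer_def)
qed

end
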